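(* Let $L$ be a $BL$-algebra and let $F:L\to[0,1]$ be a fuzzy set. Then $F$ is an $(\overline{\in},\overline{\in}\vee\overline{q})$-fuzzy implicative filter of $L$ if and only if $F$ is both an $(\overline{\in},\overline{\in}\vee\overline{q})$-fuzzy positive implicative filter of $L$ and an $(\overline{\in},\overline{\in}\vee\overline{q})$-fuzzy fantastic filter of $L$.
   Context: A $BL$-algebra is an algebra $(L,\le,\wedge,\vee,\odot,\rightarrow,0,1)$ that is a bounded lattice (least element $0$, greatest element $1$) such that $(L,\odot,1)$ is a commutative monoid, $z\le x\rightarrow y$ iff $x\odot z\le y$, $x\wedge y=x\odot(x\rightarrow y)$, and $(x\rightarrow y)\vee(y\rightarrow x)=1$, for all $x,y,z\in L$. Write $x'=x\rightarrow 0$. For $x\in L$ and $t\in(0,1]$, the fuzzy point $U(x;t)$ is said to belong to $F$, written $U(x;t)\in F$, if $F(x)\ge t$, and to be quasi-coincident with $F$, written $U(x;t)\,q\,F$, if $F(x)+t>1$; $\overline{\in}$ and $\overline{q}$ denote the negations of these relations, and $U(x;t)\,\overline{\in}\vee\overline{q}\,F$ means $U(x;t)\,\overline{\in}\,F$ or $U(x;t)\,\overline{q}\,F$. A fuzzy set $F$ is an $(\overline{\in},\overline{\in}\vee\overline{q})$-fuzzy filter of $L$ if for all $t,r\in(0,1]$ and $x,y\in L$: (i) if $U(x\odot y;\min\{t,r\})\,\overline{\in}\,F$ then $U(x;t)\,\overline{\in}\vee\overline{q}\,F$ or $U(y;r)\,\overline{\in}\vee\overline{q}\,F$; (ii) if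 $x\le y$ and $U(y;r)\,\overline{\in}\,F$ then $U(x;r)\,\overline{\in}\vee\overline{q}\,F$. Such an $F$ is called an $(\overline{\in},\overline{\in}\vee\overline{q})$-fuzzy implicative filter if moreover $\max\{F(x\rightarrow z),0.5\}\ge\min\{F(x\rightarrow(z'\rightarrow y)),F(y\rightarrow z)\}$ for all $x,y,z\in L$; an $(\overline{\in},\overline{\in}\vee\overline{q})$-fuzzy positive implicative filter if moreover $\max\{F(x\rightarrow z),0.5\}\ge\min\{F(x\rightarrow(y\rightarrow z)),F(x\rightarrow y)\}$ for all $x,y,z\in L$; and an $(\overline{\in},\overline{\in}\vee\overline{q})$-fuzzy fantastic filter if moreover $\max\{F(((x\rightarrow y)\rightarrow y)\rightarrow x),0.5\}\ge\min\{F(z\rightarrow(y\rightarrow x)),F(z)\}$ for all $x,y,z\in L$. *)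

theory Defs
  imports Complex_Main
begin

unbundle lattice_syntax

text \<open>
  The constants $0$ and $1$ of the algebra are \<open>\<bottom>\<close> and \<open>\<top>\<close>; no assumption \<open>\<bottom> \<noteq> \<top>\<close> is made,
  so the one-element algebra is included.
\<close>

class bl_algebra = bounded_lattice +
  fixes bl_mult :: "'a \<Rightarrow> 'a \<Rightarrow> 'a"  (infixl \<open>\<odot>\<close> 75)
    and bl_imp :: "'a \<Rightarrow> 'a \<Rightarrow> 'a"  (infixr \<open>\<rightarrow>\<close> 70)
  assumes mult_assoc: "(x \<odot> y) \<odot> z = x \<odot> (y \<odot> z)"
    and mult_commute: "x \<odot> y = y \<odot> x"
    and top_mult: "\<top> \<odot> x = x"
    and residuation: "z \<le> x \<rightarrow> y \<longleftrightarrow> x \<odot> z \<le> y"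
    and divisibility: "x \<sqinter> y = x \<odot> (x \<rightarrow> y)"
    and prelinearity: "(x \<rightarrow> y) \<squnion> (y \<rightarrow> x) = \<top>"

definition bl_neg :: "'a::bl_algebra \<Rightarrow> 'a" where
  "bl_neg x = x \<rightarrow> \<bottom>"

definition fuzzy_set :: "('a \<Rightarrow> real) \<Rightarrow> bool" where
  "fuzzy_set F \<longleftrightarrow> (\<forall>x. 0 \<le> F x \<and> F x \<le> 1)"

text \<open>
  A fuzzy point \<open>U(x;t)\<close> is given by its support \<open>x\<close> and its value \<open>t\<close>; the range
  \<open>t \<in> {0<..1}\<close> is imposed where fuzzy points are quantified over.
\<close>

definition point_belongs :: "'a \<Rightarrow> real \<Rightarrow> ('a \<Rightarrow> real) \<Rightarrow> bool" where
  "point_belongs x t F \<longleftrightarrow> F x \<ge> t"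

definition point_quasi_coincident :: "'a \<Rightarrow> real \<Rightarrow> ('a \<Rightarrow> real) \<Rightarrow> bool" where
  "point_quasi_coincident x t F \<longleftrightarrow> F x + t > 1"

definition point_not_in_or_not_q :: "'a \<Rightarrow> real \<Rightarrow> ('a \<Rightarrow> real) \<Rightarrow> bool" where
  "point_not_in_or_not_q x t F \<longleftrightarrow> \<not> point_belongs x t F \<or> \<not> point_quasi_coincident x t F"

definition fuzzy_filter :: "('a::bl_algebra \<Rightarrow> real) \<Rightarrow> bool" where
  "fuzzy_filter F \<longleftrightarrow> fuzzy_set F \<and>
    (\<forall>t\<in>{0<..1}. \<forall>r\<in>{0<..1}. \<forall>x y.
      \<not> point_belongs (x \<odot> y) (min t r) F \<longrightarrow>
        point_not_in_or_not_q x t F \<or> point_not_in_or_not_q y r F) \<and>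
    (\<forall>r\<in>{0<..1}. \<forall>x y.
      x \<le> y \<and> \<not> point_belongs y r F \<longrightarrow> point_not_in_or_not_q x r F)"

definition fuzzy_implicative_filter :: "('a::bl_algebra \<Rightarrow> real) \<Rightarrow> bool" where
  "fuzzy_implicative_filter F \<longleftrightarrow> fuzzy_filter F \<and>
    (\<forall>x y z. max (F (x \<rightarrow> z)) (1/2) \<ge> min (F (x \<rightarrow> (bl_neg z \<rightarrow> y))) (F (y \<rightarrow> z)))"

definition fuzzy_positive_implicative_filter :: "('a::bl_algebra \<Rightarrow> real) \<Rightarrow> bool" where
  "fuzzy_positive_implicative_filter F \<longleftrightarrow> fuzzy_filter F \<and>
    (\<forall>x y z. max (F (x \<rightarrow> z)) (1/2) \<ge> min (F (x \<rightarrow> (y \<rightarrow> z))) (F (x \<rightarrow> y)))"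

definition fuzzy_fantastic_filter :: "('a::bl_algebra \<Rightarrow> real) \<Rightarrow> bool" where
  "fuzzy_fantastic_filter F \<longleftrightarrow> fuzzy_filter F \<and>
    (\<forall>x y z. max (F (((x \<rightarrow> y) \<rightarrow> y) \<rightarrow> x)) (1/2) \<ge> min (F (z \<rightarrow> (y \<rightarrow> x))) (F z))"

end

theory Submission
  imports Defs
begin

text \<open>
  Each of the three conditions on \<open>F\<close> says that all level sets \<open>{x. s \<le> F x}\<close> with \<open>s > 1/2\<close>
  have the corresponding crisp property, and these level sets are filters or empty. For a crisp
  filter \<open>D\<close>, the implicative condition is contraction: \<open>w \<in> D\<close> whenever \<open>w' \<rightarrow> w \<in> D\<close>. It follows
  from the other two because \<open>w' \<rightarrow> w \<in> D\<close> gives \<open>w'' \<in> D\<close> by the positive implicative condition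
  at \<open>w' \<rightarrow> (w \<rightarrow> 0)\<close>, and the fantastic condition gives \<open>w'' \<rightarrow> w \<in> D\<close>.
\<close>

section \<open>Arithmetic of residuation\<close>

context bl_algebra
begin

lemma mult_top: "x \<odot> \<top> = x"
  by (metis mult_commute top_mult)

lemma mult_left_commute: "x \<odot> (y \<odot> z) = y \<odot> (x \<odot> z)"
  by (metis mult_assoc mult_commute)

lemmas mult_ac = mult_assoc mult_commute mult_left_commute

lemma mult_mono_right: "y \<le> z \<Longrightarrow> x \<odot> y \<le> x \<odot> z"
  by (meson order_refl order_trans residuation)

lemma mult_mono: "w \<le> y \<Longrightarrow> x \<le> z \<Longrightarrow> w \<odot> x \<le> y \<odot> z"
  by (metis mult_commute mult_mono_right order_trans)

lemma mult_imp_le: "x \<odot> (x \<rightarrow> y) \<le> y"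
  by (simp flip: residuation)

lemma imp_eq_top: "x \<le> y \<Longrightarrow> x \<rightarrow> y = \<top>"
  by (metis mult_top residuation top_unique)

lemma imp_top_left: "\<top> \<rightarrow> x = x"
proof (rule order.antisym)
  show "\<top> \<rightarrow> x \<le> x"
    using mult_imp_le[of \<top> x] by (simp only: top_mult)
qed (simp add: residuation top_mult)

text \<open>Both inequalities reduce by residuation to modus ponens, applied once with the
  antecedent \<open>x \<odot> y\<close> and twice with the antecedents \<open>x\<close> and
  \<open>y\<close> in turn.\<close>

lemma imp_curry: "x \<odot> y \<rightarrow> z = x \<rightarrow> (y \<rightarrow> z)"
proof (rule order.antisym)
  show "x \<odot> y \<rightarrow> z \<le> x \<rightarrow> (y \<rightarrow> z)"
    using mult_imp_le[of "x \<odot> y" z] by (simp add: residuation mult_ac)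
  have "x \<odot> (x \<rightarrow> (y \<rightarrow> z)) \<le> y \<rightarrow> z"
    by (rule mult_imp_le)
  then show "x \<rightarrow> (y \<rightarrow> z) \<le> x \<odot> y \<rightarrow> z"
    by (simp add: residuation mult_ac)
qed

lemma imp_left_commute: "x \<rightarrow> (y \<rightarrow> z) = y \<rightarrow> (x \<rightarrow> z)"
  by (metis imp_curry mult_commute)

lemma imp_antimono_left: "x \<le> y \<Longrightarrow> y \<rightarrow> z \<le> x \<rightarrow> z"
  unfolding residuation by (rule order_trans[OF mult_mono[OF _ order_refl] mult_imp_le])

lemma imp_mono_right: "y \<le> z \<Longrightarrow> x \<rightarrow> y \<le> x \<rightarrow> z"
  unfolding residuation by (rule order_trans[OF mult_imp_le])

lemma le_imp: "y \<le> x \<rightarrow> y"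
  using imp_antimono_left[OF top_greatest, of y x] by (simp only: imp_top_left)

lemma imp_trans: "(x \<rightarrow> y) \<odot> (y \<rightarrow> z) \<le> x \<rightarrow> z"
proof -
  have "(x \<odot> (x \<rightarrow> y)) \<odot> (y \<rightarrow> z) \<le> y \<odot> (y \<rightarrow> z)"
    by (rule mult_mono[OF mult_imp_le order_refl])
  also have "\<dots> \<le> z"
    by (rule mult_imp_le)
  finally show ?thesis
    by (simp add: residuation mult_assoc)
qed

text \<open>Exchanging antecedents turns the first factor into
  \<open>y \<rightarrow> (x \<rightarrow> z)\<close>, which composes with
  \<open>x \<rightarrow> y\<close> through \<open>y\<close>. The antecedent \<open>x\<close> is then
  used twice; removing the repetition is what the positive implicative property adds.\<close>

lemma imp_distrib_le: "(x \<rightarrow> (y \<rightarrow> z)) \<odot> (x \<rightarrow> y) \<le> x \<rightarrow> (x \<rightarrow> z)"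
  using imp_trans[of x y "x \<rightarrow> z"] by (simp only: imp_left_commute[of x y z] mult_commute)

end

section \<open>Crisp filters and their three properties\<close>

text \<open>The empty set is admitted, since a level set may be empty.\<close>

definition bl_filter :: "'a::bl_algebra set \<Rightarrow> bool" where
  "bl_filter D \<longleftrightarrow>
    (\<forall>x\<in>D. \<forall>y\<in>D. x \<odot> y \<in> D) \<and> (\<forall>x\<in>D. \<forall>y. x \<le> y \<longrightarrow> y \<in> D)"

definition implicative :: "'a::bl_algebra set \<Rightarrow> bool" where
  "implicative D \<longleftrightarrow>
    (\<forall>x y z. x \<rightarrow> (bl_neg z \<rightarrow> y) \<in> D \<and> y \<rightarrow> z \<in> D \<longrightarrow> x \<rightarrow> z \<in> D)"

definition positive_implicative :: "'a::bl_algebra set \<Rightarrow> bool" where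
  "positive_implicative D \<longleftrightarrow>
    (\<forall>x y z. x \<rightarrow> (y \<rightarrow> z) \<in> D \<and> x \<rightarrow> y \<in> D \<longrightarrow> x \<rightarrow> z \<in> D)"

definition fantastic :: "'a::bl_algebra set \<Rightarrow> bool" where
  "fantastic D \<longleftrightarrow>
    (\<forall>x y z. z \<rightarrow> (y \<rightarrow> x) \<in> D \<and> z \<in> D \<longrightarrow> ((x \<rightarrow> y) \<rightarrow> y) \<rightarrow> x \<in> D)"

lemma bl_filter_mult: "bl_filter D \<Longrightarrow> x \<in> D \<Longrightarrow> y \<in> D \<Longrightarrow> x \<odot> y \<in> D"
  by (simp add: bl_filter_def)

lemma bl_filter_up: "bl_filter D \<Longrightarrow> x \<in> D \<Longrightarrow> x \<le> y \<Longrightarrow> y \<in> D"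
  by (auto simp: bl_filter_def)

lemma bl_filter_top: "bl_filter D \<Longrightarrow> x \<in> D \<Longrightarrow> \<top> \<in> D"
  by (erule bl_filter_up) auto

lemma bl_filter_mp: "bl_filter D \<Longrightarrow> x \<in> D \<Longrightarrow> x \<rightarrow> y \<in> D \<Longrightarrow> y \<in> D"
  by (rule bl_filter_up[OF _ bl_filter_mult mult_imp_le])

lemma implicative_iff_contraction:
  assumes D: "bl_filter D"
  shows "implicative D \<longleftrightarrow> (\<forall>w. bl_neg w \<rightarrow> w \<in> D \<longrightarrow> w \<in> D)"
proof
  assume I: "implicative D"
  show "\<forall>w. bl_neg w \<rightarrow> w \<in> D \<longrightarrow> w \<in> D"
  proof (intro allI impI)
    fix w assume "bl_neg w \<rightarrow> w \<in> D"
    \<comment> \<open>Contraction is the instance \<open>x = \<top>\<close>,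
      \<open>y = z = w\<close> of the implicative condition.\<close>
    then have "\<top> \<rightarrow> (bl_neg w \<rightarrow> w) \<in> D" "w \<rightarrow> w \<in> D"
      using bl_filter_top[OF D] by (auto simp: imp_top_left imp_eq_top)
    then have "\<top> \<rightarrow> w \<in> D"
      using I unfolding implicative_def by blast
    then show "w \<in> D"
      by (simp add: imp_top_left)
  qed
next
  assume C: "\<forall>w. bl_neg w \<rightarrow> w \<in> D \<longrightarrow> w \<in> D"
  show "implicative D"
    unfolding implicative_def
  proof (intro allI impI, elim conjE)
    fix x y z
    assume 1: "x \<rightarrow> (bl_neg z \<rightarrow> y) \<in> D" and 2: "y \<rightarrow> z \<in> D"
    have "x \<odot> bl_neg z \<rightarrow> y \<in> D"
      using 1 by (simp add: imp_curry)
    \<comment> \<open>The premises compose through \<open>y\<close>. Moving \<open>x\<close> into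
      the conclusion leaves \<open>z' \<rightarrow> (x \<rightarrow> z)\<close>, and since
      \<open>z \<le> x \<rightarrow> z\<close>, the antecedent can be shrunk to
      \<open>(x \<rightarrow> z)'\<close>, so that contraction applies to
      \<open>w = x \<rightarrow> z\<close>.\<close>
    then have "x \<odot> bl_neg z \<rightarrow> z \<in> D"
      using 2 by (rule bl_filter_up[OF D bl_filter_mult[OF D] imp_trans])
    then have "bl_neg z \<rightarrow> (x \<rightarrow> z) \<in> D"
      by (simp only: imp_curry imp_left_commute[of x])
    moreover have "bl_neg (x \<rightarrow> z) \<le> bl_neg z"
      unfolding bl_neg_def by (rule imp_antimono_left[OF le_imp])
    ultimately have "bl_neg (x \<rightarrow> z) \<rightarrow> (x \<rightarrow> z) \<in> D"
      by (rule bl_filter_up[OF D _ imp_antimono_left])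
    then show "x \<rightarrow> z \<in> D"
      using C by blast
  qed
qed

lemma implicative_imp_positive_implicative:
  assumes D: "bl_filter D" and I: "implicative D"
  shows "positive_implicative D"
  unfolding positive_implicative_def
proof (intro allI impI, elim conjE)
  fix x y z
  assume "x \<rightarrow> (y \<rightarrow> z) \<in> D" "x \<rightarrow> y \<in> D"
  then have "x \<rightarrow> (x \<rightarrow> z) \<in> D"
    by (rule bl_filter_up[OF D bl_filter_mult[OF D] imp_distrib_le])
  \<comment> \<open>This puts the repeated antecedent into the form required by contraction:
    composing with \<open>(x \<rightarrow> z) \<rightarrow> \<bottom>\<close> yields
    \<open>x \<rightarrow> \<bottom>\<close>, which lies below
    \<open>x \<rightarrow> z\<close>.\<close>
  moreover have "x \<rightarrow> (x \<rightarrow> z) \<le> bl_neg (x \<rightarrow> z) \<rightarrow> (x \<rightarrow> z)"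
  proof -
    have "(x \<rightarrow> (x \<rightarrow> z)) \<odot> bl_neg (x \<rightarrow> z) \<le> x \<rightarrow> \<bottom>"
      unfolding bl_neg_def by (rule imp_trans)
    also have "\<dots> \<le> x \<rightarrow> z"
      by (rule imp_mono_right) simp
    finally show ?thesis
      by (simp add: residuation mult_commute)
  qed
  ultimately show "x \<rightarrow> z \<in> D"
    using I bl_filter_up[OF D] unfolding implicative_iff_contraction[OF D] by blast
qed

text \<open>The implicative condition is used with
  \<open>(x \<rightarrow> y) \<rightarrow> y\<close> for \<open>x\<close> and \<open>x\<close> for
  \<open>z\<close>. Its second premise is then \<open>y \<rightarrow> x\<close>, obtained by modus
  ponens, and its first equals \<open>\<top>\<close> because
  \<open>x' \<le> x \<rightarrow> y\<close>.\<close>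

lemma implicative_imp_fantastic:
  assumes D: "bl_filter D" and I: "implicative D"
  shows "fantastic D"
  unfolding fantastic_def
proof (intro allI impI, elim conjE)
  fix x y z
  assume "z \<rightarrow> (y \<rightarrow> x) \<in> D" "z \<in> D"
  then have yx: "y \<rightarrow> x \<in> D"
    using bl_filter_mp[OF D] by blast
  let ?a = "(x \<rightarrow> y) \<rightarrow> y"
  have "bl_neg x \<le> x \<rightarrow> y"
    unfolding bl_neg_def by (rule imp_mono_right) simp
  then have "?a \<rightarrow> (bl_neg x \<rightarrow> y) = \<top>"
    by (intro imp_eq_top imp_antimono_left)
  then have "?a \<rightarrow> (bl_neg x \<rightarrow> y) \<in> D"
    using bl_filter_top[OF D yx] by simp
  then show "?a \<rightarrow> x \<in> D"
    using I yx unfolding implicative_def by blast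
qed

lemma positive_implicative_fantastic_imp_implicative:
  assumes D: "bl_filter D" and P: "positive_implicative D" and E: "fantastic D"
  shows "implicative D"
  unfolding implicative_iff_contraction[OF D]
proof (intro allI impI)
  fix w assume w: "bl_neg w \<rightarrow> w \<in> D"
  have top: "\<top> \<in> D"
    using bl_filter_top[OF D w] .
  \<comment> \<open>An implication from \<open>w'\<close> to itself, read as the nested premise of
    the positive implicative condition; the other premise is the assumption on
    \<open>w\<close>.\<close>
  have "bl_neg w \<rightarrow> (w \<rightarrow> \<bottom>) \<in> D"
    using top by (simp add: bl_neg_def imp_eq_top)
  then have "bl_neg w \<rightarrow> \<bottom> \<in> D"
    using P w unfolding positive_implicative_def by blast
  \<comment> \<open>The fantastic condition at \<open>y = \<bottom>\<close>,
    \<open>z = \<top>\<close> has trivial premises and gives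
    \<open>w'' \<rightarrow> w\<close>.\<close>
  moreover have "\<top> \<rightarrow> (\<bottom> \<rightarrow> w) \<in> D"
    using top by (simp add: imp_eq_top)
  then have "((w \<rightarrow> \<bottom>) \<rightarrow> \<bottom>) \<rightarrow> w \<in> D"
    using E top unfolding fantastic_def by blast
  ultimately show "w \<in> D"
    unfolding bl_neg_def by (rule bl_filter_mp[OF D])
qed

lemma implicative_iff:
  "bl_filter D \<Longrightarrow> implicative D \<longleftrightarrow> positive_implicative D \<and> fantastic D"
  using implicative_imp_positive_implicative implicative_imp_fantastic
    positive_implicative_fantastic_imp_implicative by blast

section \<open>Fuzzy filters through their level sets\<close>

lemma min_le_max_iff_levels:
  fixes a b c m :: "'b::linorder"
  shows "min b c \<le> max a m \<longleftrightarrow> (\<forall>s>m. s \<le> b \<and> s \<le> c \<longrightarrow> s \<le> a)"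
proof
  assume "min b c \<le> max a m"
  then show "\<forall>s>m. s \<le> b \<and> s \<le> c \<longrightarrow> s \<le> a"
    by (auto simp: min_def max_def split: if_splits)
next
  assume levels: "\<forall>s>m. s \<le> b \<and> s \<le> c \<longrightarrow> s \<le> a"
  show "min b c \<le> max a m"
    \<comment> \<open>If \<open>min b c\<close> exceeds \<open>m\<close>, it is itself a level to
      which the hypothesis applies.\<close>
    using levels[rule_format, of "min b c"] by (cases "m < min b c") (auto simp: le_max_iff_disj not_less min_le_iff_disj)
qed

text \<open>Above \<open>1/2\<close>, belonging implies quasi-coincidence:
  \<open>s \<le> F x\<close> gives \<open>F x + s \<ge> 2 * s > 1\<close>. So a point of value
  \<open>s\<close> that belongs to \<open>F\<close> refutes \<open>point_not_in_or_not_q\<close>,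
  and the two clauses of \<open>fuzzy_filter\<close>, read contrapositively, become closure under
  product and upward closure.\<close>

lemma bl_filter_level:
  assumes F: "fuzzy_filter F" and s: "1/2 < s"
  shows "bl_filter {x. s \<le> F x}"
proof (cases "s \<le> 1")
  case True
  then have s1: "s \<in> {0<..1}"
    using s by simp
  have "s \<le> F (x \<odot> y)" if "s \<le> F x" "s \<le> F y" for x y
  proof (rule ccontr)
    assume "\<not> s \<le> F (x \<odot> y)"
    then have "point_not_in_or_not_q x s F \<or> point_not_in_or_not_q y s F"
      using F s1 unfolding fuzzy_filter_def point_belongs_def by (metis min.idem)
    then show False
      using that s by (auto simp: point_not_in_or_not_q_def point_belongs_def
          point_quasi_coincident_def)
  qed
  moreover have "s \<le> F y" if "s \<le> F x" "x \<le> y" for x y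
  proof (rule ccontr)
    assume "\<not> s \<le> F y"
    then have "point_not_in_or_not_q x s F"
      using F s1 that(2) unfolding fuzzy_filter_def point_belongs_def by blast
    then show False
      using that(1) s by (auto simp: point_not_in_or_not_q_def point_belongs_def
          point_quasi_coincident_def)
  qed
  ultimately show ?thesis
    by (auto simp: bl_filter_def)
next
  case False
  \<comment> \<open>For \<open>s > 1\<close> there is no fuzzy point of value \<open>s\<close>, but
    the level set is empty.\<close>
  have "F x \<le> 1" for x
    using F by (simp add: fuzzy_filter_def fuzzy_set_def)
  then have "{x. s \<le> F x} = {}"
    using False order_trans by blast
  then show ?thesis
    by (simp add: bl_filter_def)
qed

text \<open>With \<open>m = 1/2\<close>, each inequality between values of \<open>F\<close> splits
  into one implication per level; it remains to move the quantifier over levels outside those over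
  \<open>x\<close>, \<open>y\<close>, \<open>z\<close>.\<close>

lemma fuzzy_implicative_filter_iff_levels:
  "fuzzy_implicative_filter F \<longleftrightarrow>
    fuzzy_filter F \<and> (\<forall>s>1/2. implicative {x. s \<le> F x})"
  unfolding fuzzy_implicative_filter_def implicative_def min_le_max_iff_levels mem_Collect_eq
  by (intro conj_cong refl) blast

lemma fuzzy_positive_implicative_filter_iff_levels:
  "fuzzy_positive_implicative_filter F \<longleftrightarrow>
    fuzzy_filter F \<and> (\<forall>s>1/2. positive_implicative {x. s \<le> F x})"
  unfolding fuzzy_positive_implicative_filter_def positive_implicative_def min_le_max_iff_levels
    mem_Collect_eq
  by (intro conj_cong refl) blast

lemma fuzzy_fantastic_filter_iff_levels:
  "fuzzy_fantastic_filter F \<longleftrightarrow>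
    fuzzy_filter F \<and> (\<forall>s>1/2. fantastic {x. s \<le> F x})"
  unfolding fuzzy_fantastic_filter_def fantastic_def min_le_max_iff_levels mem_Collect_eq
  by (intro conj_cong refl) blast

theorem theorem4p8:
  fixes F :: "'a::bl_algebra \<Rightarrow> real"
  assumes "fuzzy_set F"
  shows "fuzzy_implicative_filter F \<longleftrightarrow>
           fuzzy_positive_implicative_filter F \<and> fuzzy_fantastic_filter F"
  unfolding fuzzy_implicative_filter_iff_levels fuzzy_positive_implicative_filter_iff_levels
    fuzzy_fantastic_filter_iff_levels
  \<comment> \<open>The crisp equivalence is applied at every level \<open>s > 1/2\<close>
    separately.\<close>
  using implicative_iff bl_filter_level by blast

end
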